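(* Collusion-resistant, incentive-compatible rewards require at least $N=4$ agents. That is: if, in the reporting model described in the context with $N\ge 1$ agents and margin $\Lambda>0$, there exists a payment scheme $\tau$ that is incentive-compatible with margin $\Lambda$ and collusion-resistant, then $N\ge 4$.
   Context: $\Theta$ is a finite set of types with prior $\Pr[\theta]\ge 0$, $\sum_\theta\Pr[\theta]=1$; each type $\theta$ has a probability $p_\theta=\Pr[\text{signal }1\mid\theta]\in[0,1]$, with $p_{\theta_1}\neq p_{\theta_2}$ for $\theta_1\ne\theta_2$. There are $N$ agents whose binary signals are, conditionally on the type $\theta$, independent and equal to $1$ with probability $p_\theta$ (and to $0$ otherwise). For $o\in\{0,1\}$, $\Pr[o\mid\theta]$ is $p_\theta$ if $o=1$ and $1-p_\theta$ if $o=0$; $\Pr[o]=\sum_\theta\Pr[o\mid\theta]\Pr[\theta]$, assumed positive for both $o=0,1$, and $\Pr[\theta\mid o]=\Pr[o\mid\theta]\Pr[\theta]/\Pr[o]$. For $n\in\{0,\dots,N-1\}$, $P_o(n)=\sum_{\theta}\Pr[\theta\mid o]\binom{N-1}{n}p_\theta^{\,n}(1-p_\theta)^{N-1-n}$. A payment scheme is a collection of reals $\tau(r,n)\ge 0$, $r\in\{0,1\}$, $n\in\{0,\dots,N-1\}$: the amount paid to an agent who reports $r$ when exactly $n$ of the other $N-1$ agents report $1$. It is incentive-compatible with margin $\Lambda>0$ if $$\sum_{n=0}^{N-1}P_1(n)\big(\tau(1,n)-\tau(0,n)\big)\ge\Lambda\quad\text{and}\quad \sum_{n=0}^{N-1}P_0(n)\big(\tau(0,n)-\tau(1,n)\big)\ge\Lambda.$$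 It is collusion-resistant if no symmetric pure lying strategy profile is an equilibrium, i.e. all of the following hold: (i) (everybody always reporting $1$ is not an equilibrium) $\tau(0,N-1)>\tau(1,N-1)$; (ii) (everybody always reporting $0$ is not an equilibrium) $\tau(1,0)>\tau(0,0)$; (iii) (everybody always reporting the opposite of the observed signal is not an equilibrium) either $\sum_{n=0}^{N-1}P_0(n)\big(\tau(0,N-1-n)-\tau(1,N-1-n)\big)>0$ or $\sum_{n=0}^{N-1}P_1(n)\big(\tau(1,N-1-n)-\tau(0,N-1-n)\big)>0$. *)

theory Defs
  imports Complex_Main
begin

text \<open>
  The conditional probability \<open>Pr[o | \<theta>]\<close> of signal \<open>o \<in> {0, 1}\<close>, as a function of
  \<open>q = p\<^sub>\<theta>\<close>. Signals and reports are natural numbers; only the values 0 and 1 are used.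
\<close>
definition signal_prob :: "real \<Rightarrow> nat \<Rightarrow> real" where
  "signal_prob q b = (if b = 1 then q else 1 - q)"

definition marginal :: "'t set \<Rightarrow> ('t \<Rightarrow> real) \<Rightarrow> ('t \<Rightarrow> real) \<Rightarrow> nat \<Rightarrow> real" where
  "marginal \<Theta> prior p b = (\<Sum>\<theta>\<in>\<Theta>. signal_prob (p \<theta>) b * prior \<theta>)"

definition posterior :: "'t set \<Rightarrow> ('t \<Rightarrow> real) \<Rightarrow> ('t \<Rightarrow> real) \<Rightarrow> nat \<Rightarrow> 't \<Rightarrow> real" where
  "posterior \<Theta> prior p b \<theta> = signal_prob (p \<theta>) b * prior \<theta> / marginal \<Theta> prior p b"

text \<open>
  \<open>P\<^sub>b(n)\<close>: the belief of an agent with signal \<open>b\<close> that exactly \<open>n\<close> of the other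
  \<open>N - 1\<close> agents have signal 1. Signals are conditionally independent given the type,
  so this is a posterior mixture of binomial distributions.
\<close>
definition count_prob ::
  "'t set \<Rightarrow> ('t \<Rightarrow> real) \<Rightarrow> ('t \<Rightarrow> real) \<Rightarrow> nat \<Rightarrow> nat \<Rightarrow> nat \<Rightarrow> real" where
  "count_prob \<Theta> prior p N b n =
     (\<Sum>\<theta>\<in>\<Theta>. posterior \<Theta> prior p b \<theta> * real ((N - 1) choose n)
              * p \<theta> ^ n * (1 - p \<theta>) ^ (N - 1 - n))"

definition reporting_model ::
  "'t set \<Rightarrow> ('t \<Rightarrow> real) \<Rightarrow> ('t \<Rightarrow> real) \<Rightarrow> bool" where
  "reporting_model \<Theta> prior p \<longleftrightarrow>
     finite \<Theta>
   \<and> (\<forall>\<theta>\<in>\<Theta>. 0 \<le> prior \<theta>)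
   \<and> (\<Sum>\<theta>\<in>\<Theta>. prior \<theta>) = 1
   \<and> (\<forall>\<theta>\<in>\<Theta>. 0 \<le> p \<theta> \<and> p \<theta> \<le> 1)
   \<and> inj_on p \<Theta>
   \<and> (\<forall>b\<in>{0, 1}. 0 < marginal \<Theta> prior p b)"

text \<open>
  \<open>\<tau> r n\<close> is the amount paid to an agent who reports \<open>r\<close> when exactly \<open>n\<close> of the other
  \<open>N - 1\<close> agents report 1. Values outside \<open>r \<in> {0, 1}\<close>, \<open>n \<le> N - 1\<close> are irrelevant.
\<close>
definition payment_scheme :: "nat \<Rightarrow> (nat \<Rightarrow> nat \<Rightarrow> real) \<Rightarrow> bool" where
  "payment_scheme N \<tau> \<longleftrightarrow> (\<forall>r\<in>{0, 1}. \<forall>n\<in>{0..N - 1}. 0 \<le> \<tau> r n)"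

definition incentive_compatible ::
  "'t set \<Rightarrow> ('t \<Rightarrow> real) \<Rightarrow> ('t \<Rightarrow> real) \<Rightarrow> nat \<Rightarrow> real \<Rightarrow> (nat \<Rightarrow> nat \<Rightarrow> real) \<Rightarrow> bool" where
  "incentive_compatible \<Theta> prior p N \<Lambda> \<tau> \<longleftrightarrow>
     (\<Sum>n = 0..N - 1. count_prob \<Theta> prior p N 1 n * (\<tau> 1 n - \<tau> 0 n)) \<ge> \<Lambda>
   \<and> (\<Sum>n = 0..N - 1. count_prob \<Theta> prior p N 0 n * (\<tau> 0 n - \<tau> 1 n)) \<ge> \<Lambda>"

text \<open>
  None of the three symmetric pure lying profiles is an equilibrium: always reporting 1,
  always reporting 0, and always reporting the opposite of the observed signal. Under the
  last profile \<open>N - 1 - n\<close> of the other agents report 1 when \<open>n\<close> of them observe 1.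
\<close>
definition collusion_resistant ::
  "'t set \<Rightarrow> ('t \<Rightarrow> real) \<Rightarrow> ('t \<Rightarrow> real) \<Rightarrow> nat \<Rightarrow> (nat \<Rightarrow> nat \<Rightarrow> real) \<Rightarrow> bool" where
  "collusion_resistant \<Theta> prior p N \<tau> \<longleftrightarrow>
     \<tau> 0 (N - 1) > \<tau> 1 (N - 1)
   \<and> \<tau> 1 0 > \<tau> 0 0
   \<and> ((\<Sum>n = 0..N - 1. count_prob \<Theta> prior p N 0 n
                        * (\<tau> 0 (N - 1 - n) - \<tau> 1 (N - 1 - n))) > 0
     \<or> (\<Sum>n = 0..N - 1. count_prob \<Theta> prior p N 1 n
                        * (\<tau> 1 (N - 1 - n) - \<tau> 0 (N - 1 - n))) > 0)"

end

theory Submission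
  imports Defs "HOL-Analysis.Convex"
begin

text \<open>
  Write \<open>M i j\<close> for the prior expectation of \<open>p\<^sub>\<theta>\<^sup>i (1 - p\<^sub>\<theta>)\<^sup>j\<close> and
  \<open>d n = \<tau>(1, n) - \<tau>(0, n)\<close>. After multiplication by the marginal of the signal, both
  incentive constraints become linear inequalities in the \<open>d n\<close> whose coefficients are
  these mixed moments. Resistance to the two constant profiles gives \<open>d 0 > 0 > d (N - 1)\<close>,
  which is absurd for \<open>N = 1\<close>. For \<open>N = 2\<close> and \<open>N = 3\<close> a suitable combination of the two
  constraints eliminates the unsigned value of \<open>d\<close> (if any) and contradicts the log-convexity
  \<open>M (i + 1) (j + 1)\<^sup>2 \<le> M i (j + 2) M (i + 2) j\<close> of the moments.
\<close>

definition mixed_moment :: "'t set \<Rightarrow> ('t \<Rightarrow> real) \<Rightarrow> ('t \<Rightarrow> real) \<Rightarrow> nat \<Rightarrow> nat \<Rightarrow> real" where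
  "mixed_moment \<Theta> prior p i j = (\<Sum>\<theta>\<in>\<Theta>. prior \<theta> * p \<theta> ^ i * (1 - p \<theta>) ^ j)"

lemma mixed_moment_nonneg:
  assumes "reporting_model \<Theta> prior p"
  shows "0 \<le> mixed_moment \<Theta> prior p i j"
  using assms unfolding mixed_moment_def reporting_model_def
  by (intro sum_nonneg) auto

text \<open>This is Cauchy-Schwarz for the functions \<open>1 - p\<close> and \<open>p\<close> under
  the weight \<open>prior * p^i * (1 - p)^j\<close>.\<close>

lemma mixed_moment_log_convex:
  assumes "reporting_model \<Theta> prior p"
  shows "(mixed_moment \<Theta> prior p (Suc i) (Suc j))\<^sup>2
         \<le> mixed_moment \<Theta> prior p i (Suc (Suc j)) * mixed_moment \<Theta> prior p (Suc (Suc i)) j"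
proof -
  \<comment> \<open>The square root gives each Cauchy-Schwarz factor half of the weight; it squares
    back to the weight because the prior, \<open>p\<close> and \<open>1 - p\<close> are nonnegative
    on \<open>\<Theta>\<close>.\<close>
  define w where "w \<theta> = sqrt (prior \<theta> * p \<theta> ^ i * (1 - p \<theta>) ^ j)" for \<theta>
  have w: "(w \<theta>)\<^sup>2 = prior \<theta> * p \<theta> ^ i * (1 - p \<theta>) ^ j" if "\<theta> \<in> \<Theta>" for \<theta>
    using assms that unfolding w_def reporting_model_def by simp
  have "(\<Sum>\<theta>\<in>\<Theta>. (w \<theta> * (1 - p \<theta>)) * (w \<theta> * p \<theta>))\<^sup>2
        \<le> (\<Sum>\<theta>\<in>\<Theta>. (w \<theta> * (1 - p \<theta>))\<^sup>2) * (\<Sum>\<theta>\<in>\<Theta>. (w \<theta> * p \<theta>)\<^sup>2)"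
    by (rule Cauchy_Schwarz_ineq_sum)
  moreover have "(\<Sum>\<theta>\<in>\<Theta>. (w \<theta> * (1 - p \<theta>)) * (w \<theta> * p \<theta>)) = mixed_moment \<Theta> prior p (Suc i) (Suc j)"
    unfolding mixed_moment_def
    by (intro sum.cong) (simp_all add: w[unfolded power2_eq_square] mult_ac)
  moreover have "(\<Sum>\<theta>\<in>\<Theta>. (w \<theta> * (1 - p \<theta>))\<^sup>2) = mixed_moment \<Theta> prior p i (Suc (Suc j))"
    unfolding mixed_moment_def
    by (intro sum.cong) (simp_all add: w power_mult_distrib power2_eq_square[of "1 - _"])
  moreover have "(\<Sum>\<theta>\<in>\<Theta>. (w \<theta> * p \<theta>)\<^sup>2) = mixed_moment \<Theta> prior p (Suc (Suc i)) j"
    unfolding mixed_moment_def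
    by (intro sum.cong) (simp_all add: w power_mult_distrib power2_eq_square[of "p _"])
  ultimately show ?thesis by simp
qed

text \<open>The marginal cancels the posterior denominator, and the likelihood of the agent's own
  signal supplies one more factor \<open>p\<close>; for signal 0 it is \<open>1 - p\<close>.\<close>

lemma marginal_mult_count_prob_1:
  assumes "marginal \<Theta> prior p 1 \<noteq> 0"
  shows "marginal \<Theta> prior p 1 * count_prob \<Theta> prior p N 1 n
         = real ((N - 1) choose n) * mixed_moment \<Theta> prior p (Suc n) (N - 1 - n)"
  unfolding count_prob_def mixed_moment_def posterior_def sum_distrib_left
  using assms by (intro sum.cong) (simp_all add: signal_prob_def)

lemma marginal_mult_count_prob_0:
  assumes "marginal \<Theta> prior p 0 \<noteq> 0"
  shows "marginal \<Theta> prior p 0 * count_prob \<Theta> prior p N 0 n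
         = real ((N - 1) choose n) * mixed_moment \<Theta> prior p n (Suc (N - 1 - n))"
  unfolding count_prob_def mixed_moment_def posterior_def sum_distrib_left
  using assms by (intro sum.cong) (simp_all add: signal_prob_def)

lemma incentive_compatible_moments:
  assumes model: "reporting_model \<Theta> prior p" and "0 < \<Lambda>"
    and ic: "incentive_compatible \<Theta> prior p N \<Lambda> \<tau>"
  shows "0 < (\<Sum>n = 0..N - 1. real ((N - 1) choose n)
                * mixed_moment \<Theta> prior p (Suc n) (N - 1 - n) * (\<tau> 1 n - \<tau> 0 n))"
    and "(\<Sum>n = 0..N - 1. real ((N - 1) choose n)
                * mixed_moment \<Theta> prior p n (Suc (N - 1 - n)) * (\<tau> 1 n - \<tau> 0 n)) < 0"
proof -
  have pos: "0 < marginal \<Theta> prior p 1" "0 < marginal \<Theta> prior p 0"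
    using model by (auto simp: reporting_model_def)
  have "0 < marginal \<Theta> prior p 1 * (\<Sum>n = 0..N - 1. count_prob \<Theta> prior p N 1 n * (\<tau> 1 n - \<tau> 0 n))"
    using ic \<open>0 < \<Lambda>\<close> pos unfolding incentive_compatible_def by (intro mult_pos_pos) linarith+
  then show "0 < (\<Sum>n = 0..N - 1. real ((N - 1) choose n)
                * mixed_moment \<Theta> prior p (Suc n) (N - 1 - n) * (\<tau> 1 n - \<tau> 0 n))"
    using pos
    by (simp only: sum_distrib_left mult.assoc[symmetric] marginal_mult_count_prob_1[OF less_imp_neq[symmetric]])
  have "0 < marginal \<Theta> prior p 0 * (\<Sum>n = 0..N - 1. count_prob \<Theta> prior p N 0 n * (\<tau> 0 n - \<tau> 1 n))"
    using ic \<open>0 < \<Lambda>\<close> pos unfolding incentive_compatible_def by (intro mult_pos_pos) linarith+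
  then have "0 < (\<Sum>n = 0..N - 1. real ((N - 1) choose n)
                * mixed_moment \<Theta> prior p n (Suc (N - 1 - n)) * (\<tau> 0 n - \<tau> 1 n))"
    using pos
    by (simp only: sum_distrib_left mult.assoc[symmetric] marginal_mult_count_prob_0[OF less_imp_neq[symmetric]])
  also have "\<dots> = - (\<Sum>n = 0..N - 1. real ((N - 1) choose n)
                * mixed_moment \<Theta> prior p n (Suc (N - 1 - n)) * (\<tau> 1 n - \<tau> 0 n))"
    unfolding sum_negf[symmetric] by (intro sum.cong) (simp_all add: algebra_simps)
  finally show "(\<Sum>n = 0..N - 1. real ((N - 1) choose n)
                * mixed_moment \<Theta> prior p n (Suc (N - 1 - n)) * (\<tau> 1 n - \<tau> 0 n)) < 0"
    by simp
qed

text \<open>Used with \<open>x, y, z\<close> the moments of order 2, \<open>a = d 0\<close> and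
  \<open>b = - d 1\<close>. Multiplying the two constraints gives \<open>x * z < y\<^sup>2\<close>,
  against log-convexity.\<close>

lemma two_agents_infeasible:
  fixes a b x y z :: real
  assumes "0 < a" "0 < b" "0 \<le> x" "0 \<le> z" "y\<^sup>2 \<le> x * z"
    and "b * z < a * y" "a * x < b * y"
  shows False
proof -
  have "(b * z) * (a * x) < (a * y) * (b * y)"
    by (rule mult_strict_mono') (use assms in simp_all)
  then have "(a * b) * (x * z) < (a * b) * y\<^sup>2"
    by (simp add: power2_eq_square mult_ac)
  then show False
    using assms by (simp add: mult_less_cancel_left_pos)
qed

text \<open>Used with \<open>w, x, y, z\<close> the moments of order 3, \<open>a = d 0\<close>,
  \<open>b = - d 2\<close> and \<open>c = d 1\<close>, whose sign is unknown. Scaling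
  \<open>ic1\<close> by \<open>x\<close> and \<open>ic0\<close> by \<open>y\<close> produces the
  same term \<open>2 * c * x * y\<close> in both, so \<open>c\<close> drops out.\<close>

lemma three_agents_infeasible:
  fixes a b c w x y z :: real
  assumes "0 < a" "0 < b" "0 \<le> x" "0 \<le> y" "0 \<le> z"
    and wy: "x\<^sup>2 \<le> w * y" and xz: "y\<^sup>2 \<le> x * z"
    and ic1: "b * z < a * x + 2 * c * y" and ic0: "a * w + 2 * c * x < b * y"
  shows False
proof (cases "y = 0")
  \<comment> \<open>The scaling needs positive \<open>x\<close> and \<open>y\<close>. It degenerates
    when all prior mass lies on types with \<open>p\<close> equal to 0 or 1; then \<open>ic1\<close>
    alone is contradictory.\<close>
  case True
  then have "x = 0"
    using wy by simp
  then have "b * z < 0"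
    using True ic1 by simp
  then show False
    using mult_nonneg_nonneg[of b z] assms(2,5) by linarith
next
  case False
  then have "0 < y" "x \<noteq> 0"
    using \<open>0 \<le> y\<close> xz by auto
  then have "0 < x"
    using \<open>0 \<le> x\<close> by simp
  \<comment> \<open>The chain starts and ends at \<open>b * y\<^sup>2\<close>, with strict steps at
    \<open>ic1\<close> and \<open>ic0\<close>.\<close>
  have "b * y\<^sup>2 \<le> b * (x * z)"
    using xz \<open>0 < b\<close> by simp
  also have "\<dots> = x * (b * z)"
    by simp
  also have "\<dots> < x * (a * x + 2 * c * y)"
    using ic1 \<open>0 < x\<close> by simp
  also have "\<dots> = a * x\<^sup>2 + 2 * c * x * y"
    by (simp add: power2_eq_square algebra_simps)
  also have "\<dots> \<le> a * (w * y) + 2 * c * x * y"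
    using wy \<open>0 < a\<close> by simp
  also have "\<dots> = y * (a * w + 2 * c * x)"
    by (simp add: algebra_simps)
  also have "\<dots> < y * (b * y)"
    using ic0 \<open>0 < y\<close> by simp
  also have "\<dots> = b * y\<^sup>2"
    by (simp add: power2_eq_square)
  finally show False by simp
qed

theorem proposition4p1:
  fixes \<Theta> :: "'t set" and prior p :: "'t \<Rightarrow> real" and N :: nat and \<Lambda> :: real
  assumes "reporting_model \<Theta> prior p"
    and "N \<ge> 1"
    and "\<Lambda> > 0"
    and "\<exists>\<tau>. payment_scheme N \<tau>
           \<and> incentive_compatible \<Theta> prior p N \<Lambda> \<tau>
           \<and> collusion_resistant \<Theta> prior p N \<tau>"
  shows "N \<ge> 4"
proof (rule ccontr)
  assume "\<not> N \<ge> 4"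
  from assms(4) obtain \<tau> where ic: "incentive_compatible \<Theta> prior p N \<Lambda> \<tau>"
    and cr: "collusion_resistant \<Theta> prior p N \<tau>"
    by blast
  let ?M = "mixed_moment \<Theta> prior p"
  define d where "d n = \<tau> 1 n - \<tau> 0 n" for n
  have ends: "0 < d 0" "0 < - d (N - 1)"
    using cr by (auto simp: collusion_resistant_def d_def)
  note moments = incentive_compatible_moments[OF assms(1,3) ic, folded d_def]
  note nonneg = mixed_moment_nonneg[OF assms(1)]
  note convex = mixed_moment_log_convex[OF assms(1)]
  consider "N = 1" | "N = 2" | "N = 3"
    using \<open>\<not> N \<ge> 4\<close> \<open>N \<ge> 1\<close> by linarith
  then show False
  proof cases
    \<comment> \<open>The indices \<open>0\<close> and \<open>N - 1\<close> coincide, so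
      \<open>d 0\<close> would have both signs.\<close>
    case 1
    then show False using ends by simp
  next
    case 2
    show False
    proof (rule two_agents_infeasible)
      show "0 < d 0" "0 < - d 1"
        using ends 2 by simp_all
      show "(?M 1 1)\<^sup>2 \<le> ?M 0 2 * ?M 2 0"
        using convex[of 0 0] by (simp add: numeral_2_eq_2)
      show "- d 1 * ?M 2 0 < d 0 * ?M 1 1" "d 0 * ?M 0 2 < - d 1 * ?M 1 1"
        using moments 2 by (simp_all add: numeral_2_eq_2 algebra_simps)
    qed (rule nonneg)+
  next
    case 3
    show False
    proof (rule three_agents_infeasible)
      show "0 < d 0" "0 < - d 2"
        using ends 3 by simp_all
      show "(?M 1 2)\<^sup>2 \<le> ?M 0 3 * ?M 2 1" "(?M 2 1)\<^sup>2 \<le> ?M 1 2 * ?M 3 0"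
        using convex[of 0 1] convex[of 1 0] by (simp_all add: numeral_2_eq_2 numeral_3_eq_3)
      \<comment> \<open>The factor 2 is the binomial coefficient \<open>2 choose 1\<close>.\<close>
      show "- d 2 * ?M 3 0 < d 0 * ?M 1 2 + 2 * d 1 * ?M 2 1"
        "d 0 * ?M 0 3 + 2 * d 1 * ?M 1 2 < - d 2 * ?M 2 1"
        using moments 3 by (simp_all add: numeral_2_eq_2 numeral_3_eq_3 algebra_simps)
    qed (rule nonneg)+
  qed
qed

end
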